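(* Let $m,n\ge 1$ be integers. The regions of $\mathcal{A}_n^{(m)}$ are in bijection with the decorated $m$-non-nesting partitions of size $n$. Explicitly, the following map is a bijection. Given a region with word (associated $m$-sketch) $w_1\,0\,w_2$, replace each letter $\alpha_i^{(k)}$ by the label $i$ and the symbol $0$ by a red line, and for each $i\in[n]$ draw an arc joining each occurrence of $i$ to the next occurrence of $i$. The result is the arc diagram of a decorated $m$-non-nesting partition $(\Pi_1,\Pi_2)$: for $r=1,2$, the block of $\Pi_r$ with label $i$ is the set of positions in $w_r$ of the letters with subscript $i$.
   Context: $\mathcal{A}_n^{(m)}$ denotes the hyperplane arrangement in $\mathbb{R}^n$ given by $\{x_i=0 \mid i\in[n]\}\cup\{x_i=2^kx_j \mid k\in[-m,m],\ 1\le i<j\le n\}$ (so the parameter $a$ is taken to be $2$), where $[n]=\{1,\dots,n\}$ and $[p,q]$ denotes the set of integers from $p$ to $q$. A region is a connected component of the complement in $\mathbb{R}^n$ of the union of the hyperplanes. Word of a region: on a region of $\mathcal{A}_n^{(m)}$ the strict total order of the quantities $0$ and $2^kx_i$ ($i\in[n]$, $k\in[0,m]$) is constant. Writing these quantities in increasing order from left to right, with $2^kx_i$ represented by the symbol $\alpha_i^{(k)}$ and $0$ by the symbol $0$, gives a word in the symbols $\{0\}\cup\{\alpha_i^{(k)}\mid i\in[n],k\in[0,m]\}$, each used exactly once. It has the form $w_1\,0\,w_2$, where $w_1$ (resp. $w_2$) is the part of the word to the left (resp. right) of the symbol $0$. These words are called $m$-sketches of size $n$. The arc diagram of a partition of $[N]$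 has dots $1,\dots,N$ in a row, and for each block $\{i_1<\cdots<i_k\}$ an arc from $i_j$ to $i_{j+1}$ for each $j\in[k-1]$. The partition is non-nesting if no arc is nested inside another, i.e. there are no arcs $(p,q)$ and $(p',q')$ with $p<p'<q'<q$. A decorated $m$-non-nesting partition of size $n$ is an ordered pair $(\Pi_1,\Pi_2)$ of (possibly empty) non-nesting partitions such that each block has size $m+1$, the total number of blocks is $n$, and each block is given a distinct label from $[n]$. Its arc diagram is the arc diagram of $\Pi_1$, followed by a red line, followed by the arc diagram of $\Pi_2$, with each dot replaced by the label of its block. *)

theory Defs
  imports "HOL-Analysis.Analysis" "HOL-Library.Disjoint_Sets"
begin

text \<open>
  The index set \<open>[n]\<close>, used both for coordinates and for labels, is a nonempty finite linearly
  ordered type \<open>'n\<close>, so that \<open>n = CARD('n)\<close>.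
\<close>

definition arrangement :: "nat \<Rightarrow> (real ^ 'n::{finite,linorder}) set set" where
  "arrangement m =
     {{x. x $ i = 0} | i. True} \<union>
     {{x. x $ i = 2 powi k * x $ j} | i j k. i < j \<and> k \<in> {- int m..int m}}"

definition regions :: "nat \<Rightarrow> (real ^ 'n::{finite,linorder}) set set" where
  "regions m = components (UNIV - \<Union> (arrangement m))"

datatype 'n symbol = Zero | Alpha 'n nat

definition symbols :: "nat \<Rightarrow> 'n symbol set" where
  "symbols m = {Zero} \<union> {Alpha i k | i k. k \<le> m}"

fun symbol_value :: "real ^ 'n::finite \<Rightarrow> 'n symbol \<Rightarrow> real" where
  "symbol_value x Zero = 0"
| "symbol_value x (Alpha i k) = 2 ^ k * x $ i"

fun label :: "'n symbol \<Rightarrow> 'n option" where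
  "label Zero = None"
| "label (Alpha i k) = Some i"

definition is_word_of :: "nat \<Rightarrow> (real ^ 'n::finite) set \<Rightarrow> 'n symbol list \<Rightarrow> bool" where
  "is_word_of m R w \<longleftrightarrow>
     distinct w \<and> set w = symbols m \<and>
     (\<forall>x\<in>R. sorted_wrt (<) (map (symbol_value x) w))"

definition region_word :: "nat \<Rightarrow> (real ^ 'n::finite) set \<Rightarrow> 'n symbol list" where
  "region_word m R = (THE w. is_word_of m R w)"

definition left_part :: "'n symbol list \<Rightarrow> 'n symbol list" where
  "left_part w = takeWhile (\<lambda>s. s \<noteq> Zero) w"

definition right_part :: "'n symbol list \<Rightarrow> 'n symbol list" where
  "right_part w = tl (dropWhile (\<lambda>s. s \<noteq> Zero) w)"

text \<open>Positions in words are counted from 1.\<close>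

definition positions :: "'n symbol list \<Rightarrow> 'n \<Rightarrow> nat set" where
  "positions w i = {p \<in> {1..length w}. label (w ! (p - 1)) = Some i}"

definition partition_arcs :: "nat set set \<Rightarrow> (nat \<times> nat) set" where
  "partition_arcs P =
     {(sorted_list_of_set B ! j, sorted_list_of_set B ! Suc j) | B j. B \<in> P \<and> Suc j < card B}"

definition nonnesting_partition :: "nat \<Rightarrow> nat set set \<Rightarrow> bool" where
  "nonnesting_partition N P \<longleftrightarrow>
     partition_on {1..N} P \<and>
     \<not> (\<exists>p q p' q'. (p, q) \<in> partition_arcs P \<and> (p', q') \<in> partition_arcs P \<and>
          p < p' \<and> p' < q' \<and> q' < q)"

text \<open>
  A partition with labelled blocks is represented by the set of its pairs (block, label);
  injectivity of \<open>fst\<close> says that each block has just one label, injectivity of \<open>snd\<close> that labels of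
  different blocks are different. The size \<open>N\<close> of the ground set is determined by the blocks.
\<close>

type_synonym 'n labelled_partition = "(nat set \<times> 'n) set"

definition decorated_partitions ::
    "nat \<Rightarrow> ('n::finite labelled_partition \<times> 'n labelled_partition) set" where
  "decorated_partitions m =
     {(L1, L2).
        (\<forall>L\<in>{L1, L2}. (\<exists>N. nonnesting_partition N (fst ` L)) \<and>
           (\<forall>B\<in>fst ` L. card B = m + 1) \<and> inj_on fst L \<and> inj_on snd L) \<and>
        snd ` L1 \<inter> snd ` L2 = {} \<and>
        card (fst ` L1) + card (fst ` L2) = CARD('n)}"

definition labelled_blocks :: "'n symbol list \<Rightarrow> 'n labelled_partition" where
  "labelled_blocks w = {(positions w i, i) | i. positions w i \<noteq> {}}"

definition region_partition ::
    "nat \<Rightarrow> (real ^ 'n::finite) set \<Rightarrow> 'n labelled_partition \<times> 'n labelled_partition" where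
  "region_partition m R =
     (labelled_blocks (left_part (region_word m R)), labelled_blocks (right_part (region_word m R)))"

text \<open>
  A labelled arc diagram is the row of its entries, where \<open>Some i\<close> is a dot labelled \<open>i\<close> and \<open>None\<close>
  is the red line, together with the set of its arcs. Arcs refer to positions in the row, so the
  arcs of the second partition are shifted past the first diagram and the red line.
\<close>

type_synonym 'n diagram = "'n option list \<times> (nat \<times> nat) set"

definition dot_labels :: "'n labelled_partition \<Rightarrow> 'n list" where
  "dot_labels L =
     map (\<lambda>p. THE i. \<exists>B. (B, i) \<in> L \<and> p \<in> B) [1..<Suc (card (\<Union> (fst ` L)))]"

definition arc_diagram :: "'n labelled_partition \<times> 'n labelled_partition \<Rightarrow> 'n diagram" where
  "arc_diagram = (\<lambda>(L1, L2).
     (map Some (dot_labels L1) @ [None] @ map Some (dot_labels L2),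
      partition_arcs (fst ` L1) \<union>
      (\<lambda>(p, q). (length (dot_labels L1) + 1 + p, length (dot_labels L1) + 1 + q))
        ` partition_arcs (fst ` L2)))"

definition word_diagram :: "'n symbol list \<Rightarrow> 'n diagram" where
  "word_diagram w =
     (map label w,
      {(p, q). \<exists>i. p \<in> positions w i \<and> q \<in> positions w i \<and> p < q \<and>
                 \<not> (\<exists>r\<in>positions w i. p < r \<and> r < q)})"

end

theory Submission
  imports Defs
begin

text \<open>
  The complement of the arrangement consists of the points at which the values of the symbols are
  pairwise distinct (\<open>not_in_arrangement_iff\<close>). The order of two values cannot change along a
  connected subset of the complement (\<open>symbol_order_constant\<close>), and the points that induce a
  given order form a convex set (\<open>convex_cell\<close>). Hence regions correspond to the words that are
  sorted at some point, and it remains to see which words these are.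

  A word splits at the symbol \<open>Zero\<close>. On either side, passing to logarithms turns multiplication
  by 2 into a shift by 1: up to orientation the symbols with subscript \<open>i\<close> are the numbers
  \<open>h i, h i + 1, \<dots>, h i + m\<close> for a real number \<open>h i\<close>, and the word sorts all of them. Both sides
  are treated at once by the notion \<open>one_sided\<close>, with a permutation \<open>\<sigma>\<close> of the exponents that
  takes care of the orientation. The exponents of the symbols with subscript \<open>i\<close> come in a
  prescribed order, so the labels determine the word (\<open>one_sided_unique\<close>), which gives
  injectivity. An arc connects two numbers that differ by exactly 1, so arcs starting further
  right end further right, and the partition is non-nesting (\<open>decorated_side_one_sided\<close>).

  For surjectivity one needs real numbers in the order prescribed by a non-nesting partition, with
  difference 1 along every arc. Since arcs never overtake each other, these can be chosen greedily
  from left to right (\<open>ex_heights\<close>). Exponentiating, with opposite signs on the two sides, gives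
  the coordinates of a point whose region is mapped to the given pair (\<open>ex_one_sided\<close>,
  \<open>cell_of_sides\<close>).
\<close>

section \<open>Regions and their words\<close>

lemma mem_Union_arrangement:
  "x \<in> \<Union> (arrangement m) \<longleftrightarrow>
    (\<exists>i. x $ i = 0) \<or> (\<exists>i j d. i < j \<and> d \<in> {- int m..int m} \<and> x $ i = 2 powi d * x $ j)"
  unfolding arrangement_def by blast

lemma not_in_arrangement_iff:
  fixes x :: "real ^ 'n::{finite,linorder}"
  shows "x \<notin> \<Union> (arrangement m) \<longleftrightarrow> inj_on (symbol_value x) (symbols m)"
proof
  assume out: "x \<notin> \<Union> (arrangement m)"
  have nz: "x $ i \<noteq> 0"
    and ne: "i < j \<Longrightarrow> d \<in> {- int m..int m} \<Longrightarrow> x $ i \<noteq> 2 powi d * x $ j" for i j d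
    using out unfolding mem_Union_arrangement by blast+
  have less: False
    if "i < j" "k \<le> m" "l \<le> m" "2 ^ k * x $ i = 2 ^ l * x $ j" for i j k l
  proof -
    have "x $ i = 2 powi (int l - int k) * x $ j"
      using that(4) by (simp add: power_int_diff field_simps)
    then show False using ne[of i j "int l - int k"] that by auto
  qed
  have "s = t" if "s \<in> symbols m" "t \<in> symbols m" "symbol_value x s = symbol_value x t" for s t
  proof (cases s)
    case Zero
    then show ?thesis using that nz by (cases t) auto
  next
    case s: (Alpha i k)
    show ?thesis
    proof (cases t)
      case Zero
      then show ?thesis using that nz s by auto
    next
      case t: (Alpha j l)
      have kl: "k \<le> m" "l \<le> m" "2 ^ k * x $ i = 2 ^ l * x $ j"
        using that s t by (auto simp: symbols_def)
      consider "i < j" | "j < i" | "i = j" by (rule linorder_cases)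
      then show ?thesis
      proof cases
        case 3
        then show ?thesis using kl nz[of j] s t by simp
      qed (use kl less[of i j k l] less[of j i l k] in auto)
    qed
  qed
  then show "inj_on (symbol_value x) (symbols m)" by (auto simp: inj_on_def)
next
  assume inj: "inj_on (symbol_value x) (symbols m)"
  have neq: "symbol_value x s \<noteq> symbol_value x t"
    if "s \<in> symbols m" "t \<in> symbols m" "s \<noteq> t" for s t
    using inj that by (auto simp: inj_on_def)
  have "x $ i \<noteq> 0" for i
    using neq[of "Alpha i 0" Zero] by (auto simp: symbols_def)
  moreover have "x $ i \<noteq> 2 powi d * x $ j" if "i < j" "- int m \<le> d" "d \<le> int m" for i j d
  proof (cases "d \<ge> 0")
    case True
    then show ?thesis
      using neq[of "Alpha i 0" "Alpha j (nat d)"] that by (auto simp: symbols_def power_int_def)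
  next
    case False
    then show ?thesis
      using neq[of "Alpha i (nat (- d))" "Alpha j 0"] that
      by (auto simp: symbols_def power_int_def field_simps)
  qed
  ultimately show "x \<notin> \<Union> (arrangement m)"
    unfolding mem_Union_arrangement by auto
qed

lemma finite_symbols [simp]: "finite (symbols m :: 'n::finite symbol set)"
proof -
  have "symbols m = insert Zero ((\<lambda>(i, k). Alpha i k) ` ((UNIV :: 'n set) \<times> {..m}))"
    by (auto simp: symbols_def)
  then show ?thesis by simp
qed

lemma ex_sorted_word:
  fixes f :: "'a \<Rightarrow> real"
  assumes "finite S" "inj_on f S"
  shows "\<exists>w. distinct w \<and> set w = S \<and> sorted_wrt (<) (map f w)"
proof -
  let ?w = "map (inv_into S f) (sorted_list_of_set (f ` S))"
  have [simp]: "f (inv_into S f y) = y" if "y \<in> f ` S" for y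
    using that by (rule f_inv_into_f)
  have m: "map f ?w = sorted_list_of_set (f ` S)"
    using assms by (auto intro!: map_idI simp: o_def)
  have "set ?w = inv_into S f ` f ` S" using assms by simp
  also have "\<dots> = S" using assms(2) by (simp add: inv_into_image_cancel)
  finally have "set ?w = S" .
  moreover have "sorted_wrt (<) (map f ?w)" unfolding m by simp
  moreover have "distinct (map f ?w)" unfolding m by simp
  then have "distinct ?w" by (rule distinct_map[THEN iffD1, THEN conjunct1])
  ultimately show ?thesis by blast
qed

lemma sorted_word_unique:
  fixes f :: "'a \<Rightarrow> real"
  assumes "set w = set w'" "sorted_wrt (<) (map f w)" "sorted_wrt (<) (map f w')"
  shows "w = w'"
proof -
  have "map f w = map f w'"
    using assms by (intro strict_sorted_equal) auto
  moreover have "inj_on f (set w \<union> set w')"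
    using assms by (metis distinct_map strict_sorted_iff sup.idem)
  ultimately show ?thesis by (rule map_inj_on)
qed

lemma continuous_symbol_value: "continuous_on S (\<lambda>x. symbol_value x s)"
  by (cases s) (auto intro!: continuous_intros)

text \<open>
  Two distinct symbols never take the same value on the complement of the arrangement, so the sign
  of the difference of their values cannot change along a connected subset.
\<close>

lemma symbol_order_constant:
  fixes C :: "(real ^ 'n::{finite,linorder}) set"
  assumes "connected C" "C \<inter> \<Union> (arrangement m) = {}" "x \<in> C" "y \<in> C"
    and st: "s \<in> symbols m" "t \<in> symbols m" "symbol_value x s < symbol_value x t"
  shows "symbol_value y s < symbol_value y t"
proof (rule ccontr)
  assume "\<not> symbol_value y s < symbol_value y t"
  let ?d = "\<lambda>z. symbol_value z t - symbol_value z s"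
  have "connected (?d ` C)"
    using assms(1) by (intro connected_continuous_image continuous_intros continuous_symbol_value)
  moreover have "?d x \<in> ?d ` C" "?d y \<in> ?d ` C" using assms by blast+
  moreover have "?d y \<le> 0" "0 \<le> ?d x"
    using st \<open>\<not> symbol_value y s < symbol_value y t\<close> by auto
  ultimately have "0 \<in> ?d ` C"
    using connectedD_interval by blast
  then obtain z where z: "z \<in> C" "symbol_value z s = symbol_value z t" by auto
  then have "inj_on (symbol_value z) (symbols m)"
    using assms(2) not_in_arrangement_iff[of z m] by blast
  then have "s = t" using z st by (auto simp: inj_on_def)
  then show False using st by simp
qed

definition cell :: "'n symbol list \<Rightarrow> (real ^ 'n::finite) set" where
  "cell w = {x. sorted_wrt (<) (map (symbol_value x) w)}"

lemma symbol_value_linear: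
  "symbol_value (a *\<^sub>R x + b *\<^sub>R y) s = a * symbol_value x s + b * symbol_value y s"
  by (cases s) (simp_all add: distrib_left)

lemma convex_cell: "convex (cell w)"
proof (rule convexI)
  fix x y :: "real ^ 'a" and a b :: real
  assume *: "x \<in> cell w" "y \<in> cell w" "0 \<le> a" "0 \<le> b" "a + b = 1"
  have comb: "a * p + b * q < a * p' + b * q'" if "p < p'" "q < q'" for p q p' q'
  proof (cases "a = 0")
    case True
    then show ?thesis using * that by simp
  next
    case False
    then have "0 < a" using * by simp
    then have "a * p < a * p'" using that by simp
    moreover have "b * q \<le> b * q'" using that * by (intro mult_left_mono) auto
    ultimately show ?thesis by linarith
  qed
  have "symbol_value (a *\<^sub>R x + b *\<^sub>R y) (w ! i) < symbol_value (a *\<^sub>R x + b *\<^sub>R y) (w ! j)"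
    if "i < j" "j < length w" for i j
    unfolding symbol_value_linear
    using *(1,2) that by (intro comb) (auto simp: cell_def sorted_wrt_iff_nth_less)
  then show "a *\<^sub>R x + b *\<^sub>R y \<in> cell w"
    by (auto simp: cell_def sorted_wrt_iff_nth_less)
qed

lemma cell_disjoint_arrangement:
  fixes w :: "'n::{finite,linorder} symbol list"
  assumes "set w = symbols m"
  shows "cell w \<inter> \<Union> (arrangement m) = {}"
proof -
  have "x \<notin> \<Union> (arrangement m)" if "x \<in> cell w" for x
    using that assms unfolding cell_def not_in_arrangement_iff
    by (metis distinct_map mem_Collect_eq strict_sorted_iff)
  then show ?thesis by blast
qed

lemma region_is_word_of:
  assumes "R \<in> regions m" "x \<in> R" "x \<in> cell w" "set w = symbols m"
  shows "is_word_of m R w"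
proof -
  have R: "connected R" "R \<inter> \<Union> (arrangement m) = {}"
    using in_components_connected[of R] in_components_subset[of R] assms(1)
    unfolding regions_def by (metis, auto)
  have dist: "distinct w"
    using assms(3) unfolding cell_def mem_Collect_eq strict_sorted_iff distinct_map by blast
  have "sorted_wrt (<) (map (symbol_value y) w)" if "y \<in> R" for y
  proof -
    have "symbol_value y (w ! i) < symbol_value y (w ! j)" if "i < j" "j < length w" for i j
    proof (rule symbol_order_constant[OF R \<open>x \<in> R\<close> \<open>y \<in> R\<close>])
      show "w ! i \<in> symbols m" "w ! j \<in> symbols m"
        using that assms(4) nth_mem[of _ w] by auto
      show "symbol_value x (w ! i) < symbol_value x (w ! j)"
        using assms(3) that by (simp add: cell_def sorted_wrt_iff_nth_less)
    qed
    then show ?thesis by (simp add: sorted_wrt_iff_nth_less)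
  qed
  then show ?thesis using dist assms by (auto simp: is_word_of_def)
qed

lemma region_nonempty: "R \<in> regions m \<Longrightarrow> \<exists>x. x \<in> R"
  unfolding regions_def by (drule in_components_nonempty) (simp add: ex_in_conv)

lemma ex1_word:
  assumes "R \<in> regions m"
  shows "\<exists>!w. is_word_of m R w"
proof -
  obtain x where x: "x \<in> R" using region_nonempty[OF assms] by blast
  then have "x \<notin> \<Union> (arrangement m)"
    using in_components_subset[OF assms[unfolded regions_def]] by (metis DiffD2 subsetD)
  then have "inj_on (symbol_value x) (symbols m)" unfolding not_in_arrangement_iff .
  then obtain w where "distinct w" "set w = symbols m" "sorted_wrt (<) (map (symbol_value x) w)"
    using ex_sorted_word[OF finite_symbols] by blast
  then have "is_word_of m R w"
    using region_is_word_of[OF assms x, of w] by (simp add: cell_def)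
  moreover have "w' = w" if "is_word_of m R w'" for w'
    using that x \<open>is_word_of m R w\<close> unfolding is_word_of_def
    by (intro sorted_word_unique[of w' w "symbol_value x"]) simp_all
  ultimately show ?thesis by (rule ex1I)
qed

lemma is_word_of_region_word: "R \<in> regions m \<Longrightarrow> is_word_of m R (region_word m R)"
  unfolding region_word_def by (rule theI') (rule ex1_word)

lemma region_word_eqI: "R \<in> regions m \<Longrightarrow> is_word_of m R w \<Longrightarrow> region_word m R = w"
  using ex1_word is_word_of_region_word by blast

text \<open>
  Two regions with the same word both meet the cell of that word, which is connected and avoids the
  arrangement.
\<close>

lemma inj_on_region_word:
  "inj_on (region_word m) (regions m :: (real ^ 'n::{finite,linorder}) set set)"
proof (rule inj_onI)
  fix R R' :: "(real ^ 'n::{finite,linorder}) set"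
  assume *: "R \<in> regions m" "R' \<in> regions m" and eq: "region_word m R = region_word m R'"
  define w where "w = region_word m R"
  have w: "is_word_of m R w" "is_word_of m R' w"
    using * eq is_word_of_region_word unfolding w_def by metis+
  obtain x y where xy: "x \<in> R" "y \<in> R'" using * region_nonempty by metis
  have "x \<in> cell w" "y \<in> cell w" using w xy by (auto simp: is_word_of_def cell_def)
  moreover have "cell w \<subseteq> UNIV - \<Union> (arrangement m)"
    using cell_disjoint_arrangement w by (fastforce simp: is_word_of_def)
  ultimately show "R = R'"
    using * xy convex_connected[OF convex_cell, of w]
      joinable_components_eq[of "cell w" "UNIV - \<Union> (arrangement m)" R R']
    unfolding regions_def by blast
qed

lemma ex_region_of_word:
  fixes w :: "'n::{finite,linorder} symbol list"
  assumes "x \<in> cell w" "set w = symbols m"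
  shows "\<exists>R \<in> regions m. region_word m R = w"
proof -
  let ?U = "UNIV - \<Union> (arrangement m) :: (real ^ 'n::{finite,linorder}) set"
  have "x \<in> ?U" using assms cell_disjoint_arrangement by blast
  then obtain R where "R \<in> regions m" "x \<in> R"
    unfolding regions_def by (metis Union_components UnionE)
  then show ?thesis using region_is_word_of[OF _ _ assms] region_word_eqI by blast
qed

section \<open>Arc diagrams of words\<close>

definition consecutive :: "nat set \<Rightarrow> (nat \<times> nat) set" where
  "consecutive B = {(p, q). p \<in> B \<and> q \<in> B \<and> p < q \<and> \<not> (\<exists>r\<in>B. p < r \<and> r < q)}"

lemma consecutive_eq_nth:
  assumes "finite B"
  shows "consecutive B = {(sorted_list_of_set B ! j, sorted_list_of_set B ! Suc j) | j. Suc j < card B}"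
proof -
  define e where "e = sorted_list_of_set B"
  have e: "set e = B" "length e = card B" using assms by (auto simp: e_def)
  have iff: "e ! a < e ! b \<longleftrightarrow> a < b" if "a < card B" "b < card B" for a b
  proof -
    have mono: "e ! c < e ! d" if "c < d" "d < card B" for c d
      using sorted_wrt_nth_less[of "(<)" e c d] that e by (simp add: e_def)
    show ?thesis
      using mono[of a b] mono[of b a] that by (cases a b rule: linorder_cases) auto
  qed
  have mem: "p \<in> B \<longleftrightarrow> (\<exists>a < card B. p = e ! a)" for p
    using e by (metis in_set_conv_nth)
  show ?thesis
    unfolding e_def[symmetric]
  proof (intro set_eqI iffI)
    fix pq assume "pq \<in> consecutive B"
    then obtain p q where pq: "pq = (p, q)" "p \<in> B" "q \<in> B" "p < q" "\<And>r. r \<in> B \<Longrightarrow> \<not> (p < r \<and> r < q)"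
      by (auto simp: consecutive_def)
    then obtain a b where ab: "a < card B" "b < card B" "p = e ! a" "q = e ! b" by (auto simp: mem)
    then have "a < b" using pq iff by blast
    moreover have "\<not> Suc a < b"
    proof
      assume "Suc a < b"
      then have "e ! Suc a \<in> B" using ab unfolding mem by (intro exI[of _ "Suc a"]) simp
      then show False
        using pq(5)[of "e ! Suc a"] ab iff[of a "Suc a"] iff[of "Suc a" b] \<open>Suc a < b\<close> by auto
    qed
    ultimately have "b = Suc a" by simp
    then show "pq \<in> {(e ! j, e ! Suc j) | j. Suc j < card B}" using ab pq by auto
  next
    fix pq assume "pq \<in> {(e ! j, e ! Suc j) | j. Suc j < card B}"
    then obtain j where j: "pq = (e ! j, e ! Suc j)" "Suc j < card B" by auto
    have "\<not> (e ! j < r \<and> r < e ! Suc j)" if "r \<in> B" for r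
      using iff that j by (auto simp: mem)
    moreover have "e ! j \<in> B" "e ! Suc j \<in> B" using j mem Suc_lessD by blast+
    ultimately show "pq \<in> consecutive B"
      using j iff[of j "Suc j"] by (auto simp: consecutive_def)
  qed
qed

lemma partition_arcs_eq:
  assumes "\<And>B. B \<in> P \<Longrightarrow> finite B"
  shows "partition_arcs P = (\<Union>B\<in>P. consecutive B)"
  using assms unfolding partition_arcs_def by (fastforce simp: consecutive_eq_nth)

lemma finite_positions [simp]: "finite (positions w i)"
  by (simp add: positions_def)

definition word_arcs :: "'n symbol list \<Rightarrow> (nat \<times> nat) set" where
  "word_arcs w = (\<Union>i. consecutive (positions w i))"

lemma word_diagram_eq: "word_diagram w = (map label w, word_arcs w)"
  by (auto simp: word_diagram_def word_arcs_def consecutive_def)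

lemma partition_arcs_labelled_blocks:
  "partition_arcs (fst ` labelled_blocks w) = word_arcs w"
proof -
  have "partition_arcs (fst ` labelled_blocks w) = (\<Union>B\<in>fst ` labelled_blocks w. consecutive B)"
    by (rule partition_arcs_eq) (auto simp: labelled_blocks_def)
  also have "\<dots> = word_arcs w"
    by (force simp: labelled_blocks_def word_arcs_def consecutive_def)
  finally show ?thesis .
qed

lemma label_Some: "s \<noteq> Zero \<Longrightarrow> \<exists>i. label s = Some i"
  by (cases s) auto

lemma Union_positions:
  assumes "Zero \<notin> set w"
  shows "(\<Union>i. positions w i) = {1..length w}"
proof -
  have "\<exists>i. p \<in> positions w i" if "p \<in> {1..length w}" for p
  proof -
    have "w ! (p - 1) \<in> set w" using that by (intro nth_mem) auto
    then have "w ! (p - 1) \<noteq> Zero" using assms by metis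
    then show ?thesis using that label_Some by (auto simp: positions_def)
  qed
  then show ?thesis by (auto simp: positions_def)
qed

lemma Union_labelled_blocks:
  assumes "Zero \<notin> set w"
  shows "\<Union> (fst ` labelled_blocks w) = {1..length w}"
  unfolding Union_positions[OF assms, symmetric] by (force simp: labelled_blocks_def)

lemma dot_labels_labelled_blocks:
  assumes "Zero \<notin> set w"
  shows "map Some (dot_labels (labelled_blocks w)) = map label w"
proof (rule nth_equalityI)
  have len: "length (dot_labels (labelled_blocks w)) = length w"
    using assms by (simp add: dot_labels_def Union_labelled_blocks del: upt_Suc)
  then show "length (map Some (dot_labels (labelled_blocks w))) = length (map label w)" by simp
  fix p assume "p < length (map Some (dot_labels (labelled_blocks w)))"
  then have p: "p < length w" using len by simp
  then have "w ! p \<noteq> Zero" using assms nth_mem by metis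
  then obtain i where i: "label (w ! p) = Some i" using label_Some by blast
  have "(THE j. \<exists>B. (B, j) \<in> labelled_blocks w \<and> Suc p \<in> B) = i"
    by (rule the_equality) (use p i in \<open>auto simp: labelled_blocks_def positions_def
          intro: exI[of _ "Suc p"]\<close>)
  then show "map Some (dot_labels (labelled_blocks w)) ! p = map label w ! p"
    using p i assms by (simp add: dot_labels_def Union_labelled_blocks del: upt_Suc)
qed

lemma positions_append:
  "positions (u @ v) i = positions u i \<union> (\<lambda>p. length u + p) ` positions v i"
proof -
  have "p \<in> positions (u @ v) i \<longleftrightarrow>
      p \<in> positions u i \<union> (\<lambda>p. length u + p) ` positions v i" for p
  proof (cases "p \<le> length u")
    case True
    then show ?thesis by (auto simp: positions_def nth_append)
  next
    case False
    then obtain r where "p = length u + r" "r > 0" by (metis less_imp_add_positive not_le)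
    then show ?thesis by (auto simp: positions_def nth_append image_iff)
  qed
  then show ?thesis by blast
qed

lemma positions_Zero: "positions [Zero] i = {}"
  by (auto simp: positions_def)

lemma consecutive_shift:
  "consecutive ((\<lambda>p. c + p) ` B) = (\<lambda>(p, q). (c + p, c + q)) ` consecutive B"
  by (auto simp: consecutive_def image_iff)

lemma arc_diagram_split:
  assumes "Zero \<notin> set u" "Zero \<notin> set v"
    and disj: "\<And>i. positions u i = {} \<or> positions v i = {}"
  shows "arc_diagram (labelled_blocks u, labelled_blocks v) = word_diagram (u @ Zero # v)"
proof -
  have len: "length (dot_labels (labelled_blocks u)) = length u"
    using dot_labels_labelled_blocks[OF assms(1)] by (metis length_map)
  have pos: "positions (u @ Zero # v) i = positions u i \<union> (\<lambda>p. length u + 1 + p) ` positions v i" for i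
    using positions_append[of "u @ [Zero]" v i] positions_append[of u "[Zero]" i]
    by (simp add: positions_Zero)
  have [simp]: "consecutive {} = {}" by (simp add: consecutive_def)
  have "consecutive (positions (u @ Zero # v) i) = consecutive (positions u i) \<union>
      (\<lambda>(p, q). (length u + 1 + p, length u + 1 + q)) ` consecutive (positions v i)" for i
    unfolding pos consecutive_shift[symmetric] using disj[of i] by auto
  then have "word_arcs (u @ Zero # v) = word_arcs u \<union>
      (\<lambda>(p, q). (length u + 1 + p, length u + 1 + q)) ` word_arcs v"
    unfolding word_arcs_def image_UN UN_Un_distrib[symmetric] by (rule SUP_cong[OF refl])
  then show ?thesis
    using assms by (simp add: arc_diagram_def word_diagram_eq partition_arcs_labelled_blocks
        dot_labels_labelled_blocks len)
qed

section \<open>Words on one side of zero\<close>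

text \<open>
  For suitable \<open>h\<close> the key of a symbol is the binary logarithm of its absolute value, negated to the
  left of the origin: there \<open>\<sigma>\<close> reverses \<open>{..m}\<close>, to the right it is the identity. In both cases the
  key increases with the value of the symbol, and the symbols with subscript \<open>i\<close> and exponent at
  most \<open>m\<close> have the keys \<open>h i, h i + 1, \<dots>, h i + m\<close>.
\<close>

fun key :: "(nat \<Rightarrow> nat) \<Rightarrow> ('n \<Rightarrow> real) \<Rightarrow> 'n symbol \<Rightarrow> real" where
  "key \<sigma> h Zero = 0"
| "key \<sigma> h (Alpha i k) = h i + real (\<sigma> k)"

definition one_sided :: "nat \<Rightarrow> (nat \<Rightarrow> nat) \<Rightarrow> 'n set \<Rightarrow> ('n \<Rightarrow> real) \<Rightarrow> 'n symbol list \<Rightarrow> bool" where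
  "one_sided m \<sigma> I h u \<longleftrightarrow>
     set u = {Alpha i k | i k. i \<in> I \<and> k \<le> m} \<and> sorted_wrt (<) (map (key \<sigma> h) u)"

lemma one_sided_distinct: "one_sided m \<sigma> I h u \<Longrightarrow> distinct u"
  unfolding one_sided_def strict_sorted_iff distinct_map by blast

lemma key_less_iff:
  assumes "one_sided m \<sigma> I h u" "a < length u" "b < length u"
  shows "key \<sigma> h (u ! a) < key \<sigma> h (u ! b) \<longleftrightarrow> a < b"
proof -
  have mono: "key \<sigma> h (u ! c) < key \<sigma> h (u ! d)" if "c < d" "d < length u" for c d
    using assms(1) that by (simp add: one_sided_def sorted_wrt_iff_nth_less)
  show ?thesis
    using mono[of a b] mono[of b a] assms by (cases a b rule: linorder_cases) auto
qed

text \<open>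
  Reading from left to right, the occurrences of \<open>i\<close> run through the exponents in the order
  prescribed by \<open>\<sigma>\<close>. A one-sided word can therefore be recovered from its labels alone.
\<close>

lemma positions_one_sided:
  assumes u: "one_sided m \<sigma> I h u" and \<sigma>: "bij_betw \<sigma> {..m} {..m}" and i: "i \<in> I"
  shows "card (positions u i) = Suc m"
    and "j \<le> m \<Longrightarrow> \<exists>k\<le>m. \<sigma> k = j \<and> u ! (sorted_list_of_set (positions u i) ! j - 1) = Alpha i k"
proof -
  define e where "e = sorted_list_of_set (positions u i)"
  \<comment> \<open>For a position \<open>p\<close> of \<open>i\<close> the key of the symbol there is \<open>h i + g p\<close>.\<close>
  define g where "g p = (THE j. \<exists>k. j = \<sigma> k \<and> u ! (p - 1) = Alpha i k)" for p
  have set_e: "set e = positions u i" by (simp add: e_def)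
  have set_u: "set u = {Alpha i k | i k. i \<in> I \<and> k \<le> m}" using u by (simp add: one_sided_def)
  have pos: "\<exists>k\<le>m. g p = \<sigma> k \<and> u ! (p - 1) = Alpha i k \<and> p \<in> {1..length u}"
    if "p \<in> positions u i" for p
  proof -
    have p: "p \<in> {1..length u}" "label (u ! (p - 1)) = Some i"
      using that by (auto simp: positions_def)
    then have "u ! (p - 1) \<in> set u" by (intro nth_mem) auto
    then obtain k where k: "k \<le> m" "u ! (p - 1) = Alpha i k"
      using p unfolding set_u by auto
    then have "g p = \<sigma> k" unfolding g_def by (intro the_equality) auto
    then show ?thesis using k p by blast
  qed
  have "g a < g b" if ab: "a < b" "a \<in> positions u i" "b \<in> positions u i" for a b
  proof -
    obtain k l where "g a = \<sigma> k" "u ! (a - 1) = Alpha i k" "a \<in> {1..length u}"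
      "g b = \<sigma> l" "u ! (b - 1) = Alpha i l" "b \<in> {1..length u}"
      using pos[OF ab(2)] pos[OF ab(3)] by blast
    then show ?thesis using key_less_iff[OF u, of "a - 1" "b - 1"] ab by auto
  qed
  then have sorted: "sorted_wrt (<) (map g e)"
    using set_e sorted_wrt_nth_less[of "(<)" e] nth_mem[of _ e]
      strict_sorted_list_of_set[of "positions u i"]
    by (simp add: sorted_wrt_iff_nth_less flip: e_def)
  have "g ` positions u i = {..m}"
  proof (intro equalityI subsetI)
    fix j assume "j \<in> g ` positions u i"
    then obtain k where "k \<le> m" "j = \<sigma> k" using pos by blast
    then show "j \<in> {..m}" using \<sigma> by (auto simp: bij_betw_def)
  next
    fix j assume "j \<in> {..m}"
    then have "j \<in> \<sigma> ` {..m}" using \<sigma> by (simp add: bij_betw_def)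
    then obtain k where k: "k \<le> m" "\<sigma> k = j" by auto
    then have "Alpha i k \<in> set u" using i unfolding set_u by blast
    then obtain a where a: "a < length u" "u ! a = Alpha i k" by (metis in_set_conv_nth)
    then have "Suc a \<in> positions u i" by (auto simp: positions_def)
    moreover from this have "g (Suc a) = j" using pos[of "Suc a"] a k by auto
    ultimately show "j \<in> g ` positions u i" by blast
  qed
  then have "set (map g e) = set [0..<Suc m]" by (auto simp: set_e)
  then have g: "map g e = [0..<Suc m]"
    using sorted by (intro strict_sorted_equal) (simp_all del: upt_Suc)
  then have len: "length e = Suc m" by (metis diff_zero length_map length_upt)
  then show "card (positions u i) = Suc m" by (simp add: e_def)
  show "\<exists>k\<le>m. \<sigma> k = j \<and> u ! (sorted_list_of_set (positions u i) ! j - 1) = Alpha i k" if "j \<le> m"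
  proof -
    have "g (e ! j) = map g e ! j" using len that by simp
    also have "\<dots> = j" using that by (simp add: g del: upt_Suc)
    finally have "g (e ! j) = j" .
    moreover have "e ! j \<in> positions u i" using len that set_e nth_mem[of j e] by simp
    ultimately show ?thesis using pos unfolding e_def[symmetric] by metis
  qed
qed

lemma positions_empty:
  assumes "one_sided m \<sigma> I h u" "i \<notin> I"
  shows "positions u i = {}"
proof -
  have "label s \<noteq> Some i" if "s \<in> set u" for s
    using that assms by (auto simp: one_sided_def)
  then show ?thesis using nth_mem[of _ u] by (fastforce simp: positions_def)
qed

lemma Zero_notin_one_sided: "one_sided m \<sigma> I h u \<Longrightarrow> Zero \<notin> set u"
  by (auto simp: one_sided_def)

lemma labelled_blocks_one_sided:
  assumes "one_sided m \<sigma> I h u" "bij_betw \<sigma> {..m} {..m}"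
  shows "labelled_blocks u = (\<lambda>i. (positions u i, i)) ` I"
proof -
  have "positions u i \<noteq> {} \<longleftrightarrow> i \<in> I" for i
    using positions_one_sided(1)[OF assms, of i] positions_empty[OF assms(1), of i] by force
  then show ?thesis by (auto simp: labelled_blocks_def)
qed

lemma one_sided_unique:
  assumes u: "one_sided m \<sigma> I h u" and u': "one_sided m \<sigma> I' h' u'"
    and \<sigma>: "bij_betw \<sigma> {..m} {..m}" and eq: "labelled_blocks u = labelled_blocks u'"
  shows "u = u'"
proof (rule nth_equalityI)
  have blocks: "(\<lambda>i. (positions u i, i)) ` I = (\<lambda>i. (positions u' i, i)) ` I'"
    using eq labelled_blocks_one_sided u u' \<sigma> by metis
  then have "snd ` (\<lambda>i. (positions u i, i)) ` I = snd ` (\<lambda>i. (positions u' i, i)) ` I'" by simp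
  then have I: "I' = I" by (simp add: image_image)
  then have pos: "positions u i = positions u' i" if "i \<in> I" for i
    using blocks that by auto
  have "set u = set u'" using u u' I by (simp add: one_sided_def)
  then show len: "length u = length u'"
    using u u' one_sided_distinct distinct_card by metis
  fix p assume p: "p < length u"
  then have "u ! p \<in> set u" by simp
  then obtain i k where ik: "i \<in> I" "k \<le> m" "u ! p = Alpha i k"
    using u unfolding one_sided_def by auto
  let ?e = "sorted_list_of_set (positions u i)"
  have "Suc p \<in> set ?e" using p ik by (auto simp: positions_def)
  moreover have "length ?e = Suc m" using positions_one_sided(1)[OF u \<sigma> ik(1)] by simp
  ultimately obtain j where j: "j \<le> m" "?e ! j = Suc p" by (metis in_set_conv_nth less_Suc_eq_le)
  obtain a b where "a \<le> m" "\<sigma> a = j" "u ! p = Alpha i a" "b \<le> m" "\<sigma> b = j" "u' ! p = Alpha i b"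
    using positions_one_sided(2)[OF u \<sigma> ik(1) j(1)]
      positions_one_sided(2)[OF u' \<sigma>, of i j] ik I j pos[OF ik(1)] by auto
  moreover from this have "a = b" using \<sigma> by (auto simp: bij_betw_def inj_on_def)
  ultimately show "u ! p = u' ! p" by simp
qed

text \<open>The conditions that membership in \<open>decorated_partitions\<close> imposes on each component alone.\<close>

definition decorated_side :: "nat \<Rightarrow> 'n labelled_partition \<Rightarrow> bool" where
  "decorated_side m L \<longleftrightarrow> (\<exists>N. nonnesting_partition N (fst ` L)) \<and>
     (\<forall>B\<in>fst ` L. card B = m + 1) \<and> inj_on fst L \<and> inj_on snd L"

text \<open>
  Along an arc the key increases by exactly one, so arcs starting further right also end further
  right: this is why no arc is nested inside another.
\<close>

lemma decorated_side_one_sided: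
  assumes u: "one_sided m \<sigma> I h u" and \<sigma>: "bij_betw \<sigma> {..m} {..m}"
  shows "decorated_side m (labelled_blocks u)"
proof -
  let ?L = "labelled_blocks u"
  have L: "?L = (\<lambda>i. (positions u i, i)) ` I" using labelled_blocks_one_sided[OF assms] .
  have disj: "positions u i \<inter> positions u j = {}" if "i \<noteq> j" for i j
    using that by (auto simp: positions_def)
  have ne: "positions u i \<noteq> {}" if "i \<in> I" for i
    using positions_one_sided(1)[OF assms that] by force
  have "partition_on {1..length u} (fst ` ?L)"
  proof (rule partition_onI)
    show "\<Union> (fst ` ?L) = {1..length u}"
      using Union_labelled_blocks Zero_notin_one_sided[OF u] by metis
    show "disjnt p q" if "p \<in> fst ` ?L" "q \<in> fst ` ?L" "p \<noteq> q" for p q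
      using that disj unfolding disjnt_def labelled_blocks_def
      by (smt (verit) fst_conv imageE mem_Collect_eq)
  qed (auto simp: labelled_blocks_def)
  moreover have arc: "key \<sigma> h (u ! (q - 1)) = key \<sigma> h (u ! (p - 1)) + 1"
      "p \<in> {1..length u}" "q \<in> {1..length u}"
    if "(p, q) \<in> partition_arcs (fst ` ?L)" for p q
  proof -
    obtain i j where i: "i \<in> I" "Suc j < card (positions u i)"
      and pq: "p = sorted_list_of_set (positions u i) ! j"
      "q = sorted_list_of_set (positions u i) ! Suc j"
      using \<open>(p, q) \<in> partition_arcs (fst ` ?L)\<close> by (auto simp: partition_arcs_def L)
    have "p \<in> positions u i" "q \<in> positions u i"
      using i pq nth_mem[of _ "sorted_list_of_set (positions u i)"] by auto
    then show "p \<in> {1..length u}" "q \<in> {1..length u}" by (auto simp: positions_def)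
    have "j \<le> m" "Suc j \<le> m" using i positions_one_sided(1)[OF assms i(1)] by auto
    then show "key \<sigma> h (u ! (q - 1)) = key \<sigma> h (u ! (p - 1)) + 1"
      using positions_one_sided(2)[OF assms i(1), of j]
        positions_one_sided(2)[OF assms i(1), of "Suc j"] by (auto simp: pq)
  qed
  have "\<not> (p < p' \<and> p' < q' \<and> q' < q)"
    if "(p, q) \<in> partition_arcs (fst ` ?L)" "(p', q') \<in> partition_arcs (fst ` ?L)" for p q p' q'
  proof
    assume nest: "p < p' \<and> p' < q' \<and> q' < q"
    have "p - 1 < p' - 1" "p' - 1 < length u" "q' - 1 < q - 1" "q - 1 < length u"
      using nest arc(2,3)[OF that(1)] arc(2,3)[OF that(2)] by auto
    then have "key \<sigma> h (u ! (p - 1)) < key \<sigma> h (u ! (p' - 1))"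
      "key \<sigma> h (u ! (q' - 1)) < key \<sigma> h (u ! (q - 1))"
      using key_less_iff[OF u] by auto
    then show False using arc(1)[OF that(1)] arc(1)[OF that(2)] by simp
  qed
  ultimately have "nonnesting_partition (length u) (fst ` ?L)"
    unfolding nonnesting_partition_def by blast
  moreover have "inj_on fst ?L"
  proof -
    have "i = j" if "i \<in> I" "positions u i = positions u j" for i j
      using that ne[of i] disj[of i j] by auto
    then show ?thesis by (auto simp: L inj_on_def)
  qed
  moreover have "inj_on snd ?L" by (auto simp: L inj_on_def)
  moreover have "\<forall>B\<in>fst ` ?L. card B = m + 1"
    using positions_one_sided(1)[OF assms] by (auto simp: L)
  ultimately show ?thesis unfolding decorated_side_def by blast
qed

section \<open>Realising a labelled partition\<close>

lemma ex_between:
  fixes L U :: "real set"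
  assumes "finite L" "finite U" "\<And>l u. l \<in> L \<Longrightarrow> u \<in> U \<Longrightarrow> l < u"
  shows "\<exists>y. (\<forall>l\<in>L. l < y) \<and> (\<forall>u\<in>U. y < u)"
proof (cases "L = {} \<or> U = {}")
  case True
  then show ?thesis
    using assms by (metis Min_gr_iff Max_less_iff all_not_in_conv gt_ex lt_ex)
next
  case False
  then have "Max L < Min U" using assms by simp
  then obtain y where "Max L < y" "y < Min U" using dense by blast
  then show ?thesis using assms False by auto
qed

text \<open>
  The last clause concerns the arcs that cross the boundary between \<open>{..<N}\<close> and the positions
  still to be treated; it is the invariant of the greedy construction.
\<close>

definition heights :: "(nat \<times> nat) set \<Rightarrow> nat \<Rightarrow> (nat \<Rightarrow> real) \<Rightarrow> bool" where
  "heights A N f \<longleftrightarrow> (\<forall>q<N. \<forall>p<q. f p < f q) \<and>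
     (\<forall>p q. (p, q) \<in> A \<longrightarrow> q < N \<longrightarrow> f q = f p + 1) \<and>
     (\<forall>p q. (p, q) \<in> A \<longrightarrow> p < N \<longrightarrow> N \<le> q \<longrightarrow> (\<forall>r<N. f r < f p + 1))"

text \<open>
  Heights can be chosen greedily from left to right. If an arc starting at \<open>p\<close> ends at the next
  position, the forced height \<open>f p + 1\<close> is larger than all earlier ones by the invariant, and it respects the remaining open arcs since these start to the right of \<open>p\<close>.
  Otherwise there is room strictly between the old heights and the finitely many upper bounds.
\<close>

lemma ex_heights:
  fixes A :: "(nat \<times> nat) set"
  assumes less: "\<And>p q. (p, q) \<in> A \<Longrightarrow> p < q"
    and mono: "\<And>p q p' q'. (p, q) \<in> A \<Longrightarrow> (p', q') \<in> A \<Longrightarrow> p < p' \<longleftrightarrow> q < q'"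
  shows "\<exists>f. heights A N f"
proof (induction N)
  case (Suc N)
  then obtain f where f: "heights A N f" ..
  have f_less: "f p < f q" if "q < N" "p < q" for p q
    using f that by (auto simp: heights_def)
  have f_arc: "f q = f p + 1" if "(p, q) \<in> A" "q < N" for p q
    using f that by (auto simp: heights_def)
  have f_open: "f r < f p + 1" if "(p, q) \<in> A" "p < N" "N \<le> q" "r < N" for p q r
    using f that unfolding heights_def by blast
  obtain y where y_gt: "\<And>r. r < N \<Longrightarrow> f r < y"
    and y_arc: "\<And>p. (p, N) \<in> A \<Longrightarrow> y = f p + 1"
    and y_open: "\<And>p q. (p, q) \<in> A \<Longrightarrow> p < N \<Longrightarrow> N < q \<Longrightarrow> y < f p + 1"
  proof (cases "\<exists>p. (p, N) \<in> A")
    case True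
    then obtain p where p: "(p, N) \<in> A" by blast
    show ?thesis
    proof (rule that[of "f p + 1"])
      show "f r < f p + 1" if "r < N" for r using f_open[OF p less[OF p]] that by simp
      show "f p + 1 = f p' + 1" if "(p', N) \<in> A" for p'
        using mono[OF p that] mono[OF that p] by (metis less_irrefl nat_neq_iff)
      show "f p + 1 < f p' + 1" if "(p', q') \<in> A" "p' < N" "N < q'" for p' q'
        using mono[OF p that(1)] that f_less by simp
    qed
  next
    case False
    have "\<exists>y. (\<forall>l \<in> f ` {..<N}. l < y) \<and>
        (\<forall>u \<in> (\<lambda>p. f p + 1) ` {p. p < N \<and> (\<exists>q\<ge>N. (p, q) \<in> A)}. y < u)"
      by (rule ex_between) (use f_open in auto)
    then obtain y where y: "\<forall>r<N. f r < y" "\<forall>p q. p < N \<longrightarrow> N \<le> q \<longrightarrow> (p, q) \<in> A \<longrightarrow> y < f p + 1"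
      by auto
    show ?thesis by (rule that[of y]) (use y False less_imp_le in blast)+
  qed
  define g where "g = f(N := y)"
  have g_less: "g p < g q" if "q < Suc N" "p < q" for p q
    using that y_gt f_less by (cases "q = N") (auto simp: g_def)
  have g_arc: "g q = g p + 1" if "(p, q) \<in> A" "q < Suc N" for p q
    using that y_arc f_arc[OF that(1)] less[OF that(1)] by (cases "q = N") (auto simp: g_def)
  have g_open: "g r < g p + 1"
    if "(p, q) \<in> A" "p < Suc N" "Suc N \<le> q" "r < Suc N" for p q r
  proof (cases "p = N")
    case True
    then show ?thesis using that y_gt[of r] by (cases "r = N") (auto simp: g_def)
  next
    case False
    then show ?thesis using that y_open[OF that(1)] f_open[OF that(1), of r]
      by (cases "r = N") (auto simp: g_def)
  qed
  have "heights A (Suc N) g"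
    unfolding heights_def using g_less g_arc g_open by blast
  then show ?case by blast
qed (auto simp: heights_def)

text \<open>
  Non-nesting only excludes that one arc lies strictly inside another. Two arcs with the same left
  end or the same right end lie in one block and join consecutive elements, so they coincide.
\<close>

lemma arcs_mono:
  assumes nn: "nonnesting_partition N P"
    and arcs: "(p, q) \<in> partition_arcs P" "(p', q') \<in> partition_arcs P"
  shows "p < p' \<longleftrightarrow> q < q'"
proof -
  have part: "partition_on {1..N} P" using nn by (simp add: nonnesting_partition_def)
  then have fin: "finite B" if "B \<in> P" for B
    using that by (metis finite_atLeastAtMost finite_subset partition_onD1 Union_upper)
  have same: "B = B'" if "B \<in> P" "B' \<in> P" "r \<in> B" "r \<in> B'" for B B' r
    using partition_onD2[OF part] that by (metis disjointD disjoint_iff)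
  obtain B B' where B: "B \<in> P" "(p, q) \<in> consecutive B" "B' \<in> P" "(p', q') \<in> consecutive B'"
    using arcs fin by (auto simp: partition_arcs_eq)
  then have c: "p \<in> B" "q \<in> B" "p < q" "p' \<in> B'" "q' \<in> B'" "p' < q'"
    and mid: "\<And>r. r \<in> B \<Longrightarrow> \<not> (p < r \<and> r < q)" "\<And>r. r \<in> B' \<Longrightarrow> \<not> (p' < r \<and> r < q')"
    by (auto simp: consecutive_def)
  have pq: "p = p' \<longleftrightarrow> q = q'"
  proof
    assume "p = p'"
    then have "B = B'" using same B c by blast
    then show "q = q'" using mid c \<open>p = p'\<close> by (metis nat_neq_iff)
  next
    assume "q = q'"
    then have "B = B'" using same B c by blast
    then show "p = p'" using mid c \<open>q = q'\<close> by (metis nat_neq_iff)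
  qed
  have "\<not> (p < p' \<and> q' < q)" "\<not> (p' < p \<and> q < q')"
    using nn arcs c unfolding nonnesting_partition_def by blast+
  then show ?thesis using pq by (metis nat_neq_iff)
qed

text \<open>
  With heights that grow by one along every arc, all positions of the block labelled \<open>i\<close> have the
  heights \<open>h i, h i + 1, \<dots>, h i + m\<close>, where \<open>h i\<close> is the height of its first position. Putting
  the symbol with key \<open>h i + j\<close> at the \<open>j\<close>-th position of the block, counted from 0, gives a
  sorted word.
\<close>

lemma ex_one_sided:
  assumes L: "decorated_side m L" and \<sigma>: "bij_betw \<sigma> {..m} {..m}"
  shows "\<exists>h u. one_sided m \<sigma> (snd ` L) h u \<and> labelled_blocks u = L"
proof -
  obtain N where nn: "nonnesting_partition N (fst ` L)"
    and card: "\<And>B i. (B, i) \<in> L \<Longrightarrow> card B = Suc m"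
    and inj: "inj_on fst L" "inj_on snd L"
    using L unfolding decorated_side_def by force
  have part: "partition_on {1..N} (fst ` L)" using nn by (simp add: nonnesting_partition_def)
  let ?A = "partition_arcs (fst ` L)"
  let ?e = "sorted_list_of_set :: nat set \<Rightarrow> nat list"
  have fin: "finite B" if "(B, i) \<in> L" for B i
    using card[OF that] card.infinite by fastforce
  have sub: "B \<subseteq> {1..N}" if "(B, i) \<in> L" for B i
    using partition_onD1[OF part] that by force
  have less: "p < q" if "(p, q) \<in> ?A" for p q
  proof -
    have "?A = (\<Union>B\<in>fst ` L. consecutive B)" using fin by (intro partition_arcs_eq) auto
    then show ?thesis using that by (auto simp: consecutive_def)
  qed
  obtain f where f: "heights ?A (Suc N) f"
    using ex_heights[of ?A "Suc N", OF less arcs_mono[OF nn]] by blast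
  have f_less: "f p < f q" if "q < Suc N" "p < q" for p q
    using f that by (auto simp: heights_def)
  have f_arc: "f q = f p + 1" if "(p, q) \<in> ?A" "q < Suc N" for p q
    using f that unfolding heights_def by blast
  have nth_in: "?e B ! j \<in> B" if "(B, i) \<in> L" "j \<le> m" for B i j
    using nth_mem[of j "?e B"] card[OF that(1)] fin[OF that(1)] that(2) by simp
  have f_block: "f (?e B ! j) = f (?e B ! 0) + real j" if "(B, i) \<in> L" "j \<le> m" for B i j
    using that(2)
  proof (induction j)
    case (Suc j)
    have "(?e B ! j, ?e B ! Suc j) \<in> ?A"
      using that(1) card[OF that(1)] Suc.prems by (force simp: partition_arcs_def)
    moreover have "?e B ! Suc j < Suc N"
      using nth_in[OF that(1) Suc.prems] sub[OF that(1)] by force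
    ultimately show ?case using f_arc Suc by fastforce
  qed simp
  define \<tau> where "\<tau> = inv_into {..m} \<sigma>"
  have \<tau>: "\<sigma> (\<tau> j) = j" "\<tau> j \<le> m" if "j \<le> m" for j
    using bij_betw_inv_into_right[OF \<sigma>, of j] bij_betwE[OF bij_betw_inv_into[OF \<sigma>]] that
    by (auto simp: \<tau>_def)
  have \<tau>\<sigma>: "\<tau> (\<sigma> k) = k" "\<sigma> k \<le> m" if "k \<le> m" for k
    using bij_betw_inv_into_left[OF \<sigma>, of k] bij_betwE[OF \<sigma>] that by (auto simp: \<tau>_def)
  define h where "h i = f (?e (fst (inv_into L snd i)) ! 0)" for i
  have h: "h i = f (?e B ! 0)" if "(B, i) \<in> L" for B i
    using inv_into_f_f[OF inj(2) that] by (simp add: h_def)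
  have cover: "\<exists>B i j. (B, i) \<in> L \<and> j \<le> m \<and> p = ?e B ! j" if p: "p \<in> {1..N}" for p
  proof -
    have "p \<in> \<Union> (fst ` L)" using p partition_onD1[OF part] by blast
    then obtain B i where B: "(B, i) \<in> L" "p \<in> B" by auto
    then have "p \<in> set (?e B)" using fin by simp
    then obtain j where "j < length (?e B)" "p = ?e B ! j" by (metis in_set_conv_nth)
    moreover from this have "j \<le> m" using card[OF B(1)] by simp
    ultimately show ?thesis using B(1) by blast
  qed
  have unique: "B' = B \<and> i' = i \<and> j' = j"
    if "(B, i) \<in> L" "j \<le> m" "(B', i') \<in> L" "j' \<le> m" "?e B ! j = ?e B' ! j'" for B i j B' i' j'
  proof -
    have "B = B'"
      using partition_onD2[OF part] nth_in[OF that(1,2)] nth_in[OF that(3,4)] that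
      by (metis disjointD disjoint_iff fst_conv image_eqI)
    moreover from this have "i = i'" using inj_onD[OF inj(1), of "(B, i)" "(B', i')"] that by simp
    moreover have "j = j'"
      using that card[OF that(1)] \<open>B = B'\<close> nth_eq_iff_index_eq[of "?e B" j j'] by simp
    ultimately show ?thesis by simp
  qed
  define s where "s p = (THE a. \<exists>B i j. (B, i) \<in> L \<and> j \<le> m \<and> p = ?e B ! j \<and> a = Alpha i (\<tau> j))" for p
  have s: "s (?e B ! j) = Alpha i (\<tau> j)" if "(B, i) \<in> L" "j \<le> m" for B i j
    unfolding s_def by (rule the_equality) (use that unique[OF that] in blast)+
  have key_s: "key \<sigma> h (s p) = f p" if p: "p \<in> {1..N}" for p
  proof -
    obtain B i j where B: "(B, i) \<in> L" "j \<le> m" "p = ?e B ! j" using cover[OF p] by blast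
    then show ?thesis using s[OF B(1,2)] h[OF B(1)] f_block[OF B(1,2)] \<tau>(1)[OF B(2)] by simp
  qed
  define u where "u = map s [1..<Suc N]"
  have set_u: "set u = s ` {1..N}" by (auto simp: u_def)
  have u: "one_sided m \<sigma> (snd ` L) h u"
    unfolding one_sided_def
  proof (intro conjI equalityI subsetI)
    fix a assume "a \<in> set u"
    then obtain p where p: "p \<in> {1..N}" "a = s p" unfolding set_u by blast
    then obtain B i j where B: "(B, i) \<in> L" "j \<le> m" "p = ?e B ! j" using cover by blast
    then have "i \<in> snd ` L" by force
    then show "a \<in> {Alpha i k | i k. i \<in> snd ` L \<and> k \<le> m}" using B s p \<tau>(2) by auto
  next
    fix a assume "a \<in> {Alpha i k | i k. i \<in> snd ` L \<and> k \<le> m}"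
    then obtain B i k where B: "(B, i) \<in> L" "k \<le> m" "a = Alpha i k" by auto
    then have "a = s (?e B ! \<sigma> k)" using s[OF B(1)] \<tau>\<sigma> by simp
    moreover have "?e B ! \<sigma> k \<in> {1..N}"
      using nth_in[OF B(1)] \<tau>\<sigma> B(2) sub[OF B(1)] by blast
    ultimately show "a \<in> set u" unfolding set_u by blast
  next
    have "map (key \<sigma> h) u = map f [1..<Suc N]"
      using key_s by (auto simp: u_def)
    moreover have "sorted_wrt (<) (map f [1..<Suc N])"
      using f_less by (auto simp: sorted_wrt_iff_nth_less simp del: upt_Suc)
    ultimately show "sorted_wrt (<) (map (key \<sigma> h) u)" by metis
  qed
  have pos: "positions u i = B" if B: "(B, i) \<in> L" for B i
  proof -
    have "p \<in> positions u i \<longleftrightarrow> p \<in> {1..N} \<and> label (s p) = Some i" for p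
      by (auto simp: positions_def u_def simp del: upt_Suc)
    moreover have "p \<in> B" if p: "p \<in> {1..N}" "label (s p) = Some i" for p
    proof -
      obtain B' i' j where B': "(B', i') \<in> L" "j \<le> m" "p = ?e B' ! j" using cover[OF p(1)] by blast
      then have "i' = i" using s[OF B'(1,2)] p by simp
      then have "B' = B" using inj_onD[OF inj(2), of "(B, i)" "(B', i')"] B B'(1) by simp
      then show ?thesis using nth_in[OF B'(1,2)] B' by simp
    qed
    moreover have "p \<in> {1..N} \<and> label (s p) = Some i" if "p \<in> B" for p
    proof -
      have "p \<in> set (?e B)" using that fin[OF B] by simp
      then obtain j where "j \<le> m" "p = ?e B ! j"
        using card[OF B] by (metis in_set_conv_nth length_sorted_list_of_set less_Suc_eq_le)
      then show ?thesis using s[OF B] that sub[OF B] by auto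
    qed
    ultimately show ?thesis by blast
  qed
  have "labelled_blocks u = (\<lambda>i. (positions u i, i)) ` snd ` L"
    using labelled_blocks_one_sided[OF u \<sigma>] .
  also have "\<dots> = L" using pos by (force simp: image_iff)
  finally show ?thesis using u by blast
qed

section \<open>Gluing the two sides\<close>

lemma bij_betw_reverse: "bij_betw (\<lambda>k. m - k) {..m} {..m :: nat}"
  by (rule bij_betw_byWitness[where f' = "\<lambda>k. m - k"]) auto

lemma bij_betw_identity: "bij_betw (\<lambda>k. k) {..m} {..m :: nat}"
  by (simp add: bij_betw_def)

lemma sorted_map_cong:
  assumes "\<And>s t. s \<in> set u \<Longrightarrow> t \<in> set u \<Longrightarrow> f s < f t \<longleftrightarrow> g s < (g t :: real)"
  shows "sorted_wrt (<) (map f u) \<longleftrightarrow> sorted_wrt (<) (map (g :: 'a \<Rightarrow> real) u)"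
  using assms by (simp add: sorted_wrt_iff_nth_less)

lemma value_negative:
  assumes "x $ i = - (2 powr - (h i + real m))" "k \<le> m"
  shows "symbol_value x (Alpha i k) = - (2 powr - key (\<lambda>k. m - k) h (Alpha i k))"
proof -
  have "- key (\<lambda>k. m - k) h (Alpha i k) = real k + - (h i + real m)"
    using assms(2) by (simp add: of_nat_diff)
  then show ?thesis using assms(1) by (simp only: powr_add) (simp add: powr_realpow)
qed

lemma value_positive:
  assumes "x $ i = 2 powr h i"
  shows "symbol_value x (Alpha i k) = 2 powr key (\<lambda>k. k) h (Alpha i k)"
  using assms by (simp add: powr_add powr_realpow)

definition sides :: "nat \<Rightarrow> 'n symbol list \<Rightarrow> 'n symbol list \<Rightarrow> bool" where
  "sides m u v \<longleftrightarrow> (\<exists>I h1 h2. one_sided m (\<lambda>k. m - k) I h1 u \<and> one_sided m (\<lambda>k. k) (- I) h2 v)"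

lemma Zero_notin_sides:
  assumes "sides m u v"
  shows "Zero \<notin> set u" "Zero \<notin> set v"
proof -
  obtain I h1 h2 where "one_sided m (\<lambda>k. m - k) I h1 u" "one_sided m (\<lambda>k. k) (- I) h2 v"
    using assms unfolding sides_def by blast
  then show "Zero \<notin> set u" "Zero \<notin> set v" by (simp_all add: Zero_notin_one_sided)
qed

lemma positions_sides:
  assumes "sides m u v"
  shows "positions u i = {} \<or> positions v i = {}"
proof -
  obtain I h1 h2 where "one_sided m (\<lambda>k. m - k) I h1 u" "one_sided m (\<lambda>k. k) (- I) h2 v"
    using assms unfolding sides_def by blast
  then show ?thesis using positions_empty[of m _ I h1 u i] positions_empty[of m _ "- I" h2 v i] by blast
qed

lemma sides_left_right:
  assumes "sides m u v"
  shows "left_part (u @ Zero # v) = u" "right_part (u @ Zero # v) = v"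
proof -
  have "\<forall>s\<in>set u. s \<noteq> Zero" using Zero_notin_sides(1)[OF assms] by metis
  then show "left_part (u @ Zero # v) = u" "right_part (u @ Zero # v) = v"
    by (simp_all add: left_part_def right_part_def)
qed

lemma sides_of_cell:
  assumes x: "x \<in> cell w" and w: "set w = symbols m"
  shows "\<exists>u v. w = u @ Zero # v \<and> sides m u v"
proof -
  have "Zero \<in> set w" using w by (simp add: symbols_def)
  then obtain u v where uv: "w = u @ Zero # v" by (meson split_list)
  have sorted: "sorted_wrt (<) (map (symbol_value x) u)" "sorted_wrt (<) (map (symbol_value x) v)"
    and neg: "\<And>s. s \<in> set u \<Longrightarrow> symbol_value x s < 0"
    and pos: "\<And>s. s \<in> set v \<Longrightarrow> 0 < symbol_value x s"
    using x by (auto simp: cell_def uv sorted_wrt_append)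
  have mem: "Alpha i k \<in> set u \<union> set v \<longleftrightarrow> k \<le> m" for i k
    using w by (auto simp: uv symbols_def)
  have Zero: "Zero \<notin> set u" "Zero \<notin> set v" using neg[of Zero] pos[of Zero] by auto
  define I where "I = {i. x $ i < 0}"
  have posI: "x $ i > 0" if "i \<notin> I" for i
    using mem[of i 0] neg[of "Alpha i 0"] pos[of "Alpha i 0"] that by (auto simp: I_def)
  have set_u: "set u = {Alpha i k | i k. i \<in> I \<and> k \<le> m}"
  proof (intro equalityI subsetI)
    fix s assume s: "s \<in> set u"
    with Zero have "s \<noteq> Zero" by metis
    then obtain i k where "s = Alpha i k" by (cases s) auto
    then show "s \<in> {Alpha i k | i k. i \<in> I \<and> k \<le> m}"
      using neg[OF s] mem[of i k] s by (auto simp: I_def mult_less_0_iff)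
  next
    fix s assume "s \<in> {Alpha i k | i k. i \<in> I \<and> k \<le> m}"
    then obtain i k where "s = Alpha i k" "x $ i < 0" "k \<le> m" by (auto simp: I_def)
    then show "s \<in> set u" using pos[of s] mem[of i k] by (auto simp: zero_less_mult_iff)
  qed
  have set_v: "set v = {Alpha i k | i k. i \<in> - I \<and> k \<le> m}"
  proof (intro equalityI subsetI)
    fix s assume s: "s \<in> set v"
    with Zero have "s \<noteq> Zero" by metis
    then obtain i k where "s = Alpha i k" by (cases s) auto
    then show "s \<in> {Alpha i k | i k. i \<in> - I \<and> k \<le> m}"
      using pos[OF s] mem[of i k] s by (auto simp: I_def zero_less_mult_iff)
  next
    fix s assume "s \<in> {Alpha i k | i k. i \<in> - I \<and> k \<le> m}"
    then obtain i k where "s = Alpha i k" "x $ i > 0" "k \<le> m" using posI by auto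
    then show "s \<in> set v" using neg[of s] mem[of i k] by (auto simp: mult_less_0_iff)
  qed
  define h1 where "h1 i = - log 2 (- x $ i) - real m" for i
  define h2 where "h2 i = log 2 (x $ i)" for i
  have "symbol_value x s = - (2 powr - key (\<lambda>k. m - k) h1 s)" if "s \<in> set u" for s
    using that value_negative[of x _ h1 m] unfolding set_u by (auto simp: h1_def I_def simp del: key.simps symbol_value.simps)
  then have "sorted_wrt (<) (map (key (\<lambda>k. m - k) h1) u)"
    using sorted(1) by (subst sorted_map_cong[where g = "symbol_value x"]) auto
  moreover have "symbol_value x s = 2 powr key (\<lambda>k. k) h2 s" if "s \<in> set v" for s
    using that value_positive[of x _ h2] posI unfolding set_v by (auto simp: h2_def simp del: key.simps symbol_value.simps)
  then have "sorted_wrt (<) (map (key (\<lambda>k. k) h2) v)"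
    using sorted(2) by (subst sorted_map_cong[where g = "symbol_value x"]) auto
  ultimately have "sides m u v" using set_u set_v unfolding sides_def one_sided_def by blast
  then show ?thesis using uv by blast
qed

lemma cell_of_sides:
  fixes u v :: "'n::finite symbol list"
  assumes "sides m u v"
  shows "\<exists>x. x \<in> cell (u @ Zero # v)" "set (u @ Zero # v) = symbols m"
proof -
  obtain I h1 h2 where u: "one_sided m (\<lambda>k. m - k) I h1 u" and v: "one_sided m (\<lambda>k. k) (- I) h2 v"
    using assms unfolding sides_def by blast
  then have set_u: "set u = {Alpha i k | i k. i \<in> I \<and> k \<le> m}"
    and set_v: "set v = {Alpha i k | i k. i \<in> - I \<and> k \<le> m}"
    by (simp_all add: one_sided_def)
  then show "set (u @ Zero # v) = symbols m" by (auto simp: symbols_def)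
  \<comment> \<open>On the left the first occurrence of \<open>i\<close>, with key \<open>h1 i\<close>, is the value \<open>2 ^ m * x $ i\<close>.\<close>
  define x :: "real ^ 'n" where
    "x = (\<chi> i. if i \<in> I then - (2 powr - (h1 i + real m)) else 2 powr h2 i)"
  have xu: "symbol_value x s = - (2 powr - key (\<lambda>k. m - k) h1 s)" if "s \<in> set u" for s
    using that value_negative[of x _ h1 m] unfolding set_u by (auto simp: x_def simp del: key.simps symbol_value.simps)
  have xv: "symbol_value x s = 2 powr key (\<lambda>k. k) h2 s" if "s \<in> set v" for s
    using that value_positive[of x _ h2] unfolding set_v by (auto simp: x_def simp del: key.simps symbol_value.simps)
  have "sorted_wrt (<) (map (symbol_value x) u)"
    using u xu by (subst sorted_map_cong[where g = "key (\<lambda>k. m - k) h1"]) (auto simp: one_sided_def)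
  moreover have "sorted_wrt (<) (map (symbol_value x) v)"
    using v xv by (subst sorted_map_cong[where g = "key (\<lambda>k. k) h2"]) (auto simp: one_sided_def)
  moreover have "symbol_value x s < 0" if "s \<in> set u" for s by (simp add: xu[OF that])
  moreover have "0 < symbol_value x s" if "s \<in> set v" for s by (simp add: xv[OF that])
  ultimately have "x \<in> cell (u @ Zero # v)"
    by (force simp: cell_def sorted_wrt_append)
  then show "\<exists>x. x \<in> cell (u @ Zero # v)" by blast
qed

lemma region_sides:
  assumes "R \<in> regions m"
  shows "\<exists>u v. region_word m R = u @ Zero # v \<and> sides m u v \<and>
    region_partition m R = (labelled_blocks u, labelled_blocks v)"
proof -
  obtain x where "x \<in> R" using region_nonempty[OF assms] by blast
  then have "x \<in> cell (region_word m R)" "set (region_word m R) = symbols m"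
    using is_word_of_region_word[OF assms] by (auto simp: is_word_of_def cell_def)
  from sides_of_cell[OF this] obtain u v where "region_word m R = u @ Zero # v" "sides m u v"
    by blast
  then show ?thesis
    using sides_left_right[of m u v] by (auto simp: region_partition_def)
qed

text \<open>
  Blocks and labels are in bijection, so the condition on the number of blocks says that every
  label is used on exactly one side.
\<close>

lemma decorated_partitions_iff:
  fixes L1 L2 :: "'n::finite labelled_partition"
  shows "(L1, L2) \<in> decorated_partitions m \<longleftrightarrow>
    decorated_side m L1 \<and> decorated_side m L2 \<and> snd ` L2 = - snd ` L1"
proof -
  have card: "card (fst ` L) = card (snd ` L)" if "decorated_side m L" for L :: "'n labelled_partition"
    using that by (simp add: decorated_side_def card_image)
  have "snd ` L1 \<inter> snd ` L2 = {} \<and> card (snd ` L1) + card (snd ` L2) = CARD('n) \<longleftrightarrow>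
      snd ` L2 = - snd ` L1"
  proof (intro iffI conjI; (elim conjE)?)
    assume disj: "snd ` L1 \<inter> snd ` L2 = {}"
      and "card (snd ` L1) + card (snd ` L2) = CARD('n)"
    then have "card (snd ` L1 \<union> snd ` L2) = CARD('n)" by (simp add: card_Un_disjoint)
    then have "snd ` L1 \<union> snd ` L2 = UNIV" by (intro card_subset_eq) auto
    then show "snd ` L2 = - snd ` L1" using disj by auto
  next
    assume eq: "snd ` L2 = - snd ` L1"
    then show "snd ` L1 \<inter> snd ` L2 = {}" by auto
    show "card (snd ` L1) + card (snd ` L2) = CARD('n)"
      unfolding eq by (subst card_Un_disjoint[symmetric]) auto
  qed
  moreover have "(L1, L2) \<in> decorated_partitions m \<longleftrightarrow>
      decorated_side m L1 \<and> decorated_side m L2 \<and> snd ` L1 \<inter> snd ` L2 = {} \<and>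
      card (fst ` L1) + card (fst ` L2) = CARD('n)"
    unfolding decorated_partitions_def decorated_side_def mem_Collect_eq prod.case by blast
  ultimately show ?thesis using card[of L1] card[of L2] by metis
qed

lemma snd_labelled_blocks_one_sided:
  "one_sided m \<sigma> I h u \<Longrightarrow> bij_betw \<sigma> {..m} {..m} \<Longrightarrow> snd ` labelled_blocks u = I"
  by (simp add: labelled_blocks_one_sided image_image)

lemma decorated_partitions_of_sides:
  assumes "sides m u v"
  shows "(labelled_blocks u, labelled_blocks v) \<in> decorated_partitions m"
  using assms decorated_side_one_sided[OF _ bij_betw_reverse]
    decorated_side_one_sided[OF _ bij_betw_identity]
    snd_labelled_blocks_one_sided[OF _ bij_betw_reverse]
    snd_labelled_blocks_one_sided[OF _ bij_betw_identity]
  unfolding decorated_partitions_iff sides_def by metis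

lemma ex_sides:
  assumes "(L1, L2) \<in> decorated_partitions m"
  shows "\<exists>u v. sides m u v \<and> labelled_blocks u = L1 \<and> labelled_blocks v = L2"
proof -
  have "decorated_side m L1" "decorated_side m L2" and eq: "snd ` L2 = - snd ` L1"
    using assms unfolding decorated_partitions_iff by auto
  then show ?thesis
    using ex_one_sided[OF _ bij_betw_reverse, of m L1] ex_one_sided[OF _ bij_betw_identity, of m L2]
    unfolding sides_def eq by blast
qed

lemma sides_unique:
  assumes "sides m u v" "sides m u' v'"
    and "labelled_blocks u = labelled_blocks u'" "labelled_blocks v = labelled_blocks v'"
  shows "u = u' \<and> v = v'"
  using assms one_sided_unique[OF _ _ bij_betw_reverse] one_sided_unique[OF _ _ bij_betw_identity]
  unfolding sides_def by blast

theorem mainTheorem8: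
  fixes m :: nat
  assumes "m \<ge> 1"
  shows "(\<forall>R \<in> (regions m :: (real ^ 'n::{finite,linorder}) set set). \<exists>!w. is_word_of m R w) \<and>
    bij_betw (region_partition m)
      (regions m :: (real ^ 'n::{finite,linorder}) set set) (decorated_partitions m) \<and>
    (\<forall>R \<in> (regions m :: (real ^ 'n::{finite,linorder}) set set).
       word_diagram (region_word m R) = arc_diagram (region_partition m R))"
proof (intro conjI ballI)
  fix R :: "(real ^ 'n::{finite,linorder}) set"
  assume R: "R \<in> regions m"
  show "\<exists>!w. is_word_of m R w" using ex1_word[OF R] .
  obtain u v where uv: "region_word m R = u @ Zero # v" "sides m u v"
    "region_partition m R = (labelled_blocks u, labelled_blocks v)"
    using region_sides[OF R] by blast
  show "word_diagram (region_word m R) = arc_diagram (region_partition m R)"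
    using arc_diagram_split[OF Zero_notin_sides[OF uv(2)] positions_sides[OF uv(2)]] uv by simp
next
  let ?R = "regions m :: (real ^ 'n::{finite,linorder}) set set"
  show "bij_betw (region_partition m) ?R (decorated_partitions m)"
  proof (rule bij_betw_imageI)
    show "inj_on (region_partition m) ?R"
    proof (rule inj_onI)
      fix R R' assume "R \<in> ?R" "R' \<in> ?R" "region_partition m R = region_partition m R'"
      then have "region_word m R = region_word m R'"
        using region_sides[of R m] region_sides[of R' m] sides_unique by (metis prod.inject)
      then show "R = R'" using inj_on_region_word \<open>R \<in> ?R\<close> \<open>R' \<in> ?R\<close> by (metis inj_onD)
    qed
    show "region_partition m ` ?R = decorated_partitions m"
    proof (intro equalityI subsetI)
      fix L :: "'n labelled_partition \<times> 'n labelled_partition"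
      assume "L \<in> region_partition m ` ?R"
      then show "L \<in> decorated_partitions m"
        using region_sides decorated_partitions_of_sides by (metis (no_types, lifting) imageE)
    next
      fix L :: "'n::{finite,linorder} labelled_partition \<times> 'n labelled_partition"
      assume "L \<in> decorated_partitions m"
      then obtain u v where uv: "sides m u v" "L = (labelled_blocks u, labelled_blocks v)"
        using ex_sides by (metis prod.collapse)
      then obtain R where "R \<in> ?R" "region_word m R = u @ Zero # v"
        using cell_of_sides[OF uv(1)] ex_region_of_word by metis
      then show "L \<in> region_partition m ` ?R"
        using uv sides_left_right[OF uv(1)] by (force simp: region_partition_def)
    qed
  qed
qed

end
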